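(* Let $k$ be a positive integer and $p$ an integer with $0\le p\le k-1$. Then, as formal power series (or for $|q|<1$), \begin{align*} \sum_{n=1}^\infty a_k(n)q^n &= \frac{1}{(q;q)_\infty}\cdot \frac{kq^k}{(1-q^k)^2},\\ \sum_{n=1}^\infty a_{k,p}(n)q^n &= \frac{1}{(q;q)_\infty}\cdot \frac{(pq^{p-k}+(k-p)q^p)q^k}{(1-q^k)^2},\\ \sum_{n=1}^\infty b_k(n)q^n &= \frac{1}{(q;q)_\infty}\cdot \frac{q^k}{(1-q^k)^2}. \end{align*}
   Context: A partition of a positive integer $n$ is a weakly decreasing finite sequence of positive integers (parts) summing to $n$. For a positive integer $n$: $a_k(n)$ is the sum, over all partitions $\lambda$ of $n$, of the sum of the distinct part values of $\lambda$ that are divisible by $k$ (each distinct value counted once per partition, regardless of multiplicity); $a_{k,p}(n)$ is the sum, over all partitions $\lambda$ of $n$, of the sum of the distinct part values of $\lambda$ that are congruent to $p \pmod k$ (each counted once per partition); $b_k(n)$ is the sum, over all partitions $\lambda$ of $n$, of the sum of the distinct part values of $\lambda$ that appear at least $k$ times in $\lambda$. Notation: $(a;q)_\infty=\prod_{n=0}^\infty(1-aq^n)$. *)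

theory Defs
  imports "HOL-Analysis.Analysis" "HOL-Number_Theory.Cong"
    "HOL-Computational_Algebra.Formal_Laurent_Series"
begin

definition partitions :: "nat \<Rightarrow> nat list set" where
  "partitions n = {xs. sorted_wrt (\<ge>) xs \<and> (\<forall>x\<in>set xs. 0 < x) \<and> sum_list xs = n}"

lemma finite_partitions: "finite (partitions n)"
proof (rule finite_subset)
  have len: "length xs \<le> sum_list xs" if "\<forall>x\<in>set xs. 0 < x" for xs :: "nat list"
    using that by (induction xs) auto
  show "partitions n \<subseteq> {xs. set xs \<subseteq> {..n} \<and> length xs \<le> n}"
  proof
    fix xs assume "xs \<in> partitions n"
    then have pos: "\<forall>x\<in>set xs. 0 < x" and s: "sum_list xs = n"
      by (simp_all add: partitions_def)
    have "set xs \<subseteq> {..n}" using member_le_sum_list[of _ xs] s by auto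
    moreover have "length xs \<le> n" using len[OF pos] s by simp
    ultimately show "xs \<in> {xs. set xs \<subseteq> {..n} \<and> length xs \<le> n}" by simp
  qed
  show "finite {xs. set xs \<subseteq> {..n} \<and> length xs \<le> n}"
    by (rule finite_lists_length_le) simp
qed

text \<open>The inner sums below range over the \<^emph>\<open>set\<close> of parts, so that each distinct part value is
  counted once per partition. The multiplicity of a part is given by \<^const>\<open>count_list\<close>.\<close>

definition a_div :: "nat \<Rightarrow> nat \<Rightarrow> nat" where
  "a_div k n = (\<Sum>xs\<in>partitions n. \<Sum>m | m \<in> set xs \<and> k dvd m. m)"

definition a_res :: "nat \<Rightarrow> nat \<Rightarrow> nat \<Rightarrow> nat" where
  "a_res k p n = (\<Sum>xs\<in>partitions n. \<Sum>m | m \<in> set xs \<and> [m = p] (mod k). m)"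

definition b_rep :: "nat \<Rightarrow> nat \<Rightarrow> nat" where
  "b_rep k n = (\<Sum>xs\<in>partitions n. \<Sum>m | m \<in> set xs \<and> k \<le> count_list xs m. m)"

text \<open>\<open>qpoch_inf a q\<close> is \<open>(a; q)\<^sub>\<infinity>\<close>. It is used both for complex \<open>q\<close> and for formal power series,
  where the infinite product is taken in the metric (\<open>X\<close>-adic) topology of \<^typ>\<open>'a fps\<close>.\<close>

definition qpoch_inf :: "'a \<Rightarrow> 'a \<Rightarrow> 'a :: {t2_space, comm_ring_1}" where
  "qpoch_inf a q = (\<Prod>n. 1 - a * q ^ n)"

text \<open>The formal power series \<open>\<Sum>n\<ge>1. c n * X ^ n\<close>.\<close>

definition gen_series :: "(nat \<Rightarrow> nat) \<Rightarrow> complex fps" where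
  "gen_series c = Abs_fps (\<lambda>n. if n = 0 then 0 else of_nat (c n))"

end

(*
  Removing j copies of m shows that p(n - j m) partitions of n contain the part m at least j times,
  where p is the partition function. Exchanging the order of summation turns a_{k,p} into the
  convolution of p with the sequence n [n = p mod k], and the same count gives a_k = a_{k,0} = k b_k.
  The generating function of n [n = p mod k] is X D (X^p / (1 - X^k)).
  Euler's product for the partition function is obtained as the limit over partitions with parts
  at most N, coefficientwise for formal power series and by dominated convergence for |q| < 1.
*)
theory Submission
  imports Defs
begin

section \<open>Partitions as multisets, and removal of repeated parts\<close>

definition part_msets :: "nat set \<Rightarrow> nat \<Rightarrow> nat multiset set" where
  "part_msets A n = {M. set_mset M \<subseteq> A \<and> sum_mset M = n}"

text \<open>A weakly decreasing list is recovered from its multiset by sorting. Multisets are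
  preferred because adding or removing copies of a part needs no reordering.\<close>

lemma bij_betw_partitions: "bij_betw mset (partitions n) (part_msets {0<..} n)"
proof (rule bij_betwI')
  fix xs ys assume "xs \<in> partitions n" "ys \<in> partitions n"
  hence "sorted (rev xs)" "sorted (rev ys)"
    by (auto simp: partitions_def sorted_wrt_rev)
  hence "mset xs = mset ys \<Longrightarrow> rev xs = rev ys"
    by (metis mset_rev properties_for_sort sorted_sort_id)
  thus "(mset xs = mset ys) = (xs = ys)" by auto
next
  fix xs assume "xs \<in> partitions n"
  thus "mset xs \<in> part_msets {0<..} n"
    by (auto simp: partitions_def part_msets_def sum_mset_sum_list)
next
  fix M assume M: "M \<in> part_msets {0<..} n"
  define xs where "xs = rev (sorted_list_of_multiset M)"
  have m: "mset xs = M" by (simp add: xs_def)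
  have "xs \<in> partitions n"
    unfolding partitions_def using M m
    by (auto simp: part_msets_def sum_mset_sum_list sorted_wrt_rev xs_def
        simp flip: sum_mset_sum_list)
  thus "\<exists>xs\<in>partitions n. M = mset xs" using m by auto
qed

lemma finite_part_msets:
  assumes "0 \<notin> A"
  shows "finite (part_msets A n)"
proof (rule finite_subset)
  show "finite (part_msets {0<..} n)"
    using bij_betw_finite[OF bij_betw_partitions] finite_partitions by blast
  show "part_msets A n \<subseteq> part_msets {0<..} n"
    using assms by (auto simp: part_msets_def intro!: gr0I)
qed

lemma part_msets_mem_le: "M \<in> part_msets A n \<Longrightarrow> m \<in># M \<Longrightarrow> m \<le> n"
  by (auto simp: part_msets_def dest!: multi_member_split)

text \<open>Adding \<open>j\<close> copies of \<open>m\<close> is injective, and removing them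
  inverts it; \<open>m \<in> A\<close> keeps the enlarged multiset inside \<open>A\<close>. If
  \<open>j * m\<close> exceeds \<open>n\<close>, no multiset qualifies, since \<open>j\<close>
  copies alone overshoot the total.\<close>

lemma card_part_msets_count_ge:
  assumes "m \<in> A"
  shows "card {M \<in> part_msets A n. j \<le> count M m}
       = (if j * m \<le> n then card (part_msets A (n - j * m)) else 0)"
proof -
  have sum_decomp: "sum_mset M = sum_mset (M - replicate_mset j m) + j * m"
    and sub: "replicate_mset j m \<subseteq># M" if "j \<le> count M m" for M
  proof -
    show sub: "replicate_mset j m \<subseteq># M"
      using that by (simp add: subseteq_mset_def)
    have "sum_mset (M - replicate_mset j m + replicate_mset j m) =
        sum_mset (M - replicate_mset j m) + j * m"
      by (simp only: sum_mset.union sum_mset_replicate_mset of_nat_id)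
    thus "sum_mset M = sum_mset (M - replicate_mset j m) + j * m"
      using sub by (simp add: subset_mset.diff_add)
  qed
  show ?thesis
  proof (cases "j * m \<le> n")
    case True
    have "{M \<in> part_msets A n. j \<le> count M m}
        = (\<lambda>M. M + replicate_mset j m) ` part_msets A (n - j * m)" (is "?L = ?R")
    proof
      show "?R \<subseteq> ?L" using assms True
        by (auto simp: part_msets_def split: if_splits)
      show "?L \<subseteq> ?R"
      proof
        fix M assume M: "M \<in> ?L"
        hence "M - replicate_mset j m \<in> part_msets A (n - j * m)"
          using sum_decomp[of M] by (auto simp: part_msets_def dest: in_diffD)
        moreover have "M = M - replicate_mset j m + replicate_mset j m"
          using M sub[of M] by (simp add: subset_mset.diff_add)
        ultimately show "M \<in> ?R" by blast
      qed
    qed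
    moreover have "inj_on (\<lambda>M. M + replicate_mset j m) (part_msets A (n - j * m))"
      by (rule inj_onI) simp
    ultimately show ?thesis using True by (simp add: card_image)
  next
    case False
    hence "{M \<in> part_msets A n. j \<le> count M m} = {}"
      using sum_decomp by (force simp: part_msets_def)
    thus ?thesis using False by (metis card.empty)
  qed
qed

text \<open>The factor \<open>j\<close> lets the right-hand side be indexed by the total \<open>i = j * m\<close> that is removed,
  which makes it a convolution.\<close>

lemma sum_frequent_parts:
  assumes "j \<ge> 1"
  shows "j * (\<Sum>M\<in>part_msets {0<..} n. \<Sum>m | m \<in># M \<and> R m \<and> j \<le> count M m. m)
       = (\<Sum>i\<le>n. (if j dvd i \<and> R (i div j) then i else 0) * card (part_msets {0<..} (n - i)))"
proof -
  let ?P = "part_msets {0<..}"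
  have fin: "finite (?P n)" by (rule finite_part_msets) simp
  \<comment> \<open>The inner index set is made independent of \<open>M\<close>, with the
    multiplicity condition moved into the summand, so that the two sums can be exchanged.\<close>
  have "(\<Sum>M\<in>?P n. \<Sum>m | m \<in># M \<and> R m \<and> j \<le> count M m. m)
      = (\<Sum>M\<in>?P n. \<Sum>m \<in> {m\<in>{1..n}. R m}. if j \<le> count M m then m else 0)"
  proof (rule sum.cong[OF refl])
    fix M assume M: "M \<in> ?P n"
    have "{m. m \<in># M \<and> R m \<and> j \<le> count M m} = {m\<in>{1..n}. R m} \<inter> {m. j \<le> count M m}"
    proof (intro set_eqI iffI)
      fix m assume "m \<in> {m. m \<in># M \<and> R m \<and> j \<le> count M m}"
      thus "m \<in> {m\<in>{1..n}. R m} \<inter> {m. j \<le> count M m}"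
        using part_msets_mem_le[OF M, of m] M by (force simp: part_msets_def)
    next
      fix m assume m: "m \<in> {m\<in>{1..n}. R m} \<inter> {m. j \<le> count M m}"
      hence "0 < count M m" using assms by (auto simp del: count_greater_zero_iff)
      thus "m \<in> {m. m \<in># M \<and> R m \<and> j \<le> count M m}" using m by auto
    qed
    thus "(\<Sum>m | m \<in># M \<and> R m \<and> j \<le> count M m. m)
        = (\<Sum>m \<in> {m\<in>{1..n}. R m}. if j \<le> count M m then m else 0)"
      by (simp add: sum.inter_restrict)
  qed
  also have "\<dots> = (\<Sum>m \<in> {m\<in>{1..n}. R m}. \<Sum>M\<in>?P n. if j \<le> count M m then m else 0)"
    by (rule sum.swap)
  also have "\<dots> = (\<Sum>m \<in> {m\<in>{1..n}. R m}. m * card {M\<in>?P n. j \<le> count M m})"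
    using fin by (intro sum.cong refl) (simp flip: sum.inter_filter)
  also have "\<dots> = (\<Sum>m \<in> {m\<in>{1..n}. R m}.
      if j * m \<le> n then m * card (?P (n - j * m)) else 0)"
    by (intro sum.cong refl) (simp add: card_part_msets_count_ge)
  also have "\<dots> = (\<Sum>m \<in> {m\<in>{1..n}. R m \<and> j * m \<le> n}. m * card (?P (n - j * m)))"
    by (subst sum.inter_filter[symmetric]) (auto intro!: sum.cong)
  finally have "j * (\<Sum>M\<in>?P n. \<Sum>m | m \<in># M \<and> R m \<and> j \<le> count M m. m)
      = (\<Sum>m \<in> {m\<in>{1..n}. R m \<and> j * m \<le> n}. (j * m) * card (?P (n - j * m)))"
    by (simp add: sum_distrib_left mult.assoc)
  also have "\<dots> = (\<Sum>i \<in> {i\<in>{1..n}. j dvd i \<and> R (i div j)}. i * card (?P (n - i)))"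
  proof (rule sum.reindex_bij_witness[where i = "\<lambda>i. i div j" and j = "\<lambda>m. j * m"])
    fix i assume i: "i \<in> {i\<in>{1..n}. j dvd i \<and> R (i div j)}"
    then obtain m where m: "i = j * m" by auto
    \<comment> \<open>The bound \<open>j * m \<le> n\<close> already forces
      \<open>m \<le> n\<close>, so the reindexing by \<open>i = j * m\<close> loses no multiple of
      \<open>j\<close> up to \<open>n\<close>.\<close>
    have "m \<le> j * m" using assms by simp
    also have "j * m \<le> n" using i m by simp
    finally have "m \<le> n" .
    moreover have "0 < m" using i m by (cases m) auto
    ultimately show "i div j \<in> {m\<in>{1..n}. R m \<and> j * m \<le> n}" using i m assms by auto
  qed (use assms in auto)
  also have "\<dots> = (\<Sum>i\<in>{1..n}. if j dvd i \<and> R (i div j) then i * card (?P (n - i)) else 0)"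
    by (rule sum.inter_filter) simp
  \<comment> \<open>The new index \<open>i = 0\<close> contributes nothing because its weight is
    \<open>i\<close> itself.\<close>
  also have "\<dots> = (\<Sum>i\<le>n. (if j dvd i \<and> R (i div j) then i else 0) * card (?P (n - i)))"
    by (rule sum.mono_neutral_cong_left) auto
  finally show ?thesis .
qed

section \<open>Convolution formulas for the three sequences\<close>

lemma a_res_conv:
  "a_res k p n = (\<Sum>i\<le>n. (if [i = p] (mod k) then i else 0) * card (part_msets {0<..} (n - i)))"
proof -
  have "a_res k p n = (\<Sum>M\<in>part_msets {0<..} n. \<Sum>m | m \<in># M \<and> [m = p] (mod k). m)"
    unfolding a_res_def
    by (subst sum.reindex_bij_betw[OF bij_betw_partitions, symmetric]) simp
  also have "\<dots> = (\<Sum>M\<in>part_msets {0<..} n. \<Sum>m | m \<in># M \<and> [m = p] (mod k) \<and> 1 \<le> count M m. m)"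
    by (intro sum.cong refl) (auto simp: Suc_le_eq)
  finally show ?thesis using sum_frequent_parts[where j = 1 and n = n and R = "\<lambda>m. [m = p] (mod k)"] by simp
qed

lemma a_div_eq_a_res: "a_div k n = a_res k 0 n"
  by (simp add: a_div_def a_res_def cong_0_iff)

text \<open>With \<open>j = k\<close> and no condition on \<open>m\<close>, the convolution for
  \<open>k * b_rep k n\<close> runs over the multiples of \<open>k\<close>, which is exactly the
  convolution for residue 0.\<close>

lemma a_div_eq_b_rep:
  assumes "k \<ge> 1"
  shows "a_div k n = k * b_rep k n"
proof -
  have count: "count_list xs m = count (mset xs) m" for xs and m :: nat
    by (induction xs) auto
  have "b_rep k n = (\<Sum>M\<in>part_msets {0<..} n. \<Sum>m | m \<in># M \<and> k \<le> count M m. m)"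
    unfolding b_rep_def count
    by (subst sum.reindex_bij_betw[OF bij_betw_partitions, symmetric]) simp
  thus ?thesis
    using sum_frequent_parts[OF assms, where n = n and R = "\<lambda>_. True"]
    by (simp add: a_div_eq_a_res a_res_conv cong_0_iff)
qed

section \<open>Formal generating functions\<close>

definition part_fps :: "nat set \<Rightarrow> 'a::field fps" where
  "part_fps A = Abs_fps (\<lambda>n. of_nat (card (part_msets A n)))"

text \<open>For \<open>p < k\<close> this is the geometric series X^p / (1 - X^k), given by its
  coefficients so that no division of power series is involved.\<close>

definition residue_fps :: "nat \<Rightarrow> nat \<Rightarrow> 'a::field fps" where
  "residue_fps k p = Abs_fps (\<lambda>n. if [n = p] (mod k) then 1 else 0)"

lemma part_fps_empty: "part_fps {} = 1"
proof -
  have "part_msets {} n = (if n = 0 then {{#}} else {})" for n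
    by (auto simp: part_msets_def)
  thus ?thesis by (simp add: part_fps_def fps_eq_iff)
qed

text \<open>Partitions into parts from \<open>insert m A\<close> either avoid \<open>m\<close> or
  contain it; in the second case one copy is removed, leaving a partition of
  \<open>n - m\<close>.\<close>

lemma part_fps_insert:
  assumes "m \<notin> A" "0 \<notin> insert m A"
  shows "part_fps (insert m A) * (1 - fps_X ^ m) = part_fps A"
proof -
  have "card (part_msets (insert m A) n)
      = card (part_msets A n)
        + (if m \<le> n then card (part_msets (insert m A) (n - m)) else 0)" for n
  proof -
    have "part_msets (insert m A) n
        = part_msets A n \<union> {M \<in> part_msets (insert m A) n. 1 \<le> count M m}"
      by (auto simp: part_msets_def Suc_le_eq)
    moreover have "part_msets A n \<inter> {M \<in> part_msets (insert m A) n. 1 \<le> count M m} = {}"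
      using assms by (auto simp: part_msets_def Suc_le_eq)
    ultimately have "card (part_msets (insert m A) n)
        = card (part_msets A n) + card {M \<in> part_msets (insert m A) n. 1 \<le> count M m}"
      using assms finite_part_msets
      by (metis card_Un_disjoint finite_Un)
    thus ?thesis using card_part_msets_count_ge[of m "insert m A" n 1] by simp
  qed
  thus ?thesis
    by (auto simp: fps_eq_iff part_fps_def ring_distribs fps_X_power_mult_right_nth)
qed

lemma part_fps_prod:
  assumes "finite A" "0 \<notin> A"
  shows "part_fps A * (\<Prod>m\<in>A. 1 - fps_X ^ m) = (1 :: 'a::field fps)"
  using assms
proof (induction A rule: finite_induct)
  case empty
  thus ?case by (simp add: part_fps_empty)
next
  case (insert m A)
  have "part_fps (insert m A) * (\<Prod>m\<in>insert m A. 1 - fps_X ^ m :: 'a fps)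
      = part_fps (insert m A) * (1 - fps_X ^ m) * (\<Prod>m\<in>A. 1 - fps_X ^ m)"
    using insert.hyps by (simp only: prod.insert[OF insert.hyps] mult.assoc)
  also have "\<dots> = part_fps A * (\<Prod>m\<in>A. 1 - fps_X ^ m)"
    using insert by (subst part_fps_insert) auto
  finally show ?case using insert.IH insert.prems by simp
qed

lemma part_fps_nth_0: "0 \<notin> A \<Longrightarrow> fps_nth (part_fps A) 0 = 1"
proof -
  assume "0 \<notin> A"
  hence "part_msets A 0 = {{#}}"
    by (auto simp: part_msets_def) (metis multiset_nonemptyE subsetD)
  thus ?thesis by (simp add: part_fps_def)
qed

text \<open>No part exceeds the total. Hence each coefficient of the full partition series is
  already attained by a finite set of allowed parts.\<close>

lemma part_msets_truncate:
  assumes "n \<le> N"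
  shows "part_msets {0<..N} n = part_msets {0<..} n"
proof
  show "part_msets {0<..N} n \<subseteq> part_msets {0<..} n"
    by (auto simp: part_msets_def)
  show "part_msets {0<..} n \<subseteq> part_msets {0<..N} n"
  proof
    fix M assume M: "M \<in> part_msets {0<..} n"
    hence "x \<le> N" if "x \<in># M" for x
      using part_msets_mem_le[OF M that] assms by simp
    thus "M \<in> part_msets {0<..N} n" using M by (auto simp: part_msets_def)
  qed
qed

text \<open>Shifting by \<open>k\<close> preserves the residue class, so all coefficients from
  \<open>k\<close> on cancel; below \<open>k\<close> only \<open>n = p\<close> lies in the
  class.\<close>

lemma residue_fps_eq:
  assumes "p < k"
  shows "residue_fps k p * (1 - fps_X ^ k) = fps_X ^ p"
proof -
  have "[n - k = p] (mod k) \<longleftrightarrow> [n = p] (mod k)" if "k \<le> n" for n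
    using that by (simp add: cong_def mod_if)
  moreover have "[n = p] (mod k) \<longleftrightarrow> n = p" if "n < k" for n
    using that assms by (simp add: cong_def)
  ultimately show ?thesis using assms
    by (auto simp: fps_eq_iff residue_fps_def ring_distribs fps_X_power_mult_right_nth
        fps_X_power_nth not_le)
qed

text \<open>The Leibniz rule for \<open>fps_XD\<close> is applied to
  \<open>residue_fps k p * (1 - fps_X ^ k) = fps_X ^ p\<close>. A second multiplication by
  \<open>1 - fps_X ^ k\<close> eliminates the remaining \<open>residue_fps k p\<close>.\<close>

lemma XD_residue_fps_eq:
  assumes "p < k"
  shows "fps_XD (residue_fps k p) * (1 - fps_X ^ k)\<^sup>2
       = (of_nat p * fps_X ^ p + of_nat (k - p) * fps_X ^ (p + k) :: 'a::field fps)"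
proof -
  let ?V = "residue_fps k p :: 'a fps" and ?X = "fps_X :: 'a fps"
  have XD: "fps_XD (?X ^ n) = of_nat n * ?X ^ n" for n
    unfolding fps_XD_def o_def
    by (rule fps_ext) (auto simp: fps_X_power_nth simp flip: fps_of_nat)
  have "fps_XD (?V * (1 - ?X ^ k)) = fps_XD ?V * (1 - ?X ^ k) - of_nat k * ?X ^ k * ?V"
    by (simp add: fps_XD_def algebra_simps XD[unfolded fps_XD_def, simplified])
  hence "of_nat p * ?X ^ p = fps_XD ?V * (1 - ?X ^ k) - of_nat k * ?X ^ k * ?V"
    unfolding residue_fps_eq[OF assms] XD .
  hence *: "fps_XD ?V * (1 - ?X ^ k) = of_nat p * ?X ^ p + of_nat k * ?X ^ k * ?V"
    by simp
  have "fps_XD ?V * (1 - ?X ^ k)\<^sup>2 = fps_XD ?V * (1 - ?X ^ k) * (1 - ?X ^ k)"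
    by (simp only: power2_eq_square mult.assoc)
  also have "\<dots> = of_nat p * ?X ^ p * (1 - ?X ^ k) + of_nat k * ?X ^ k * (?V * (1 - ?X ^ k))"
    unfolding * by (simp only: distrib_right mult.assoc)
  also have "\<dots> = of_nat p * ?X ^ p + (of_nat k - of_nat p) * ?X ^ (p + k)"
    unfolding residue_fps_eq[OF assms] by (simp add: power_add algebra_simps)
  finally show ?thesis using assms by (simp add: of_nat_diff)
qed

lemma gen_series_a_res: "gen_series (a_res k p) = part_fps {0<..} * fps_XD (residue_fps k p)"
proof (rule fps_ext)
  fix n
  have "fps_nth (part_fps {0<..} * fps_XD (residue_fps k p)) n = (of_nat (a_res k p n) :: complex)"
    unfolding a_res_conv mult.commute[of "part_fps {0<..}"] fps_mult_nth
    by (auto simp: part_fps_def fps_XD_def residue_fps_def atLeast0AtMost intro!: sum.cong)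
  \<comment> \<open>\<open>gen_series\<close> forces the constant coefficient to be 0, so the
    product must be checked to vanish there too.\<close>
  moreover have "a_res k p 0 = 0" by (simp add: a_res_conv)
  ultimately show "fps_nth (gen_series (a_res k p)) n
      = fps_nth (part_fps {0<..} * fps_XD (residue_fps k p)) n"
    by (cases "n = 0") (simp_all add: gen_series_def)
qed

text \<open>The division-free form serves twice: it can be divided formally, and it can be evaluated
  at a complex point.\<close>

lemma gen_series_a_res_eq:
  assumes "p < k"
  shows "gen_series (a_res k p) * (1 - fps_X ^ k)\<^sup>2
       = part_fps {0<..} * (of_nat p * fps_X ^ p + of_nat (k - p) * fps_X ^ (p + k))"
  by (simp only: gen_series_a_res mult.assoc XD_residue_fps_eq[OF assms])

section \<open>Euler's product as a formal power series\<close>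

lemma prod_qpoch_eq: "(\<Prod>i\<le>n. 1 - q * q ^ i) = (\<Prod>m\<in>{0<..Suc n}. 1 - q ^ m)"
  for q :: "'a::comm_ring_1"
  by (rule prod.reindex_bij_witness[where i = "\<lambda>m. m - 1" and j = Suc]) auto

text \<open>The partial products invert the series for parts at most \<open>n + 1\<close>, and these
  series agree with the full one up to any given degree once \<open>n\<close> is large.\<close>

lemma qpoch_inf_fps: "qpoch_inf fps_X fps_X = inverse (part_fps {0<..} :: 'a::field fps)"
proof -
  let ?P = "part_fps {0<..} :: 'a fps" and ?Q = "\<lambda>n. part_fps {0<..Suc n} :: 'a fps"
  have P: "?P * inverse ?P = 1"
    by (rule inverse_mult_eq_1') (simp add: part_fps_nth_0)
  have Q: "?Q n * (\<Prod>i\<le>n. 1 - fps_X * fps_X ^ i) = 1" for n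
    unfolding prod_qpoch_eq by (rule part_fps_prod) auto
  have "(\<lambda>n. \<Prod>i\<le>n. 1 - fps_X * fps_X ^ i) \<longlonglongrightarrow> inverse ?P"
  proof (rule tendsto_fpsI)
    fix d
    show "\<forall>\<^sub>F n in sequentially. fps_nth (\<Prod>i\<le>n. 1 - fps_X * fps_X ^ i) d = fps_nth (inverse ?P) d"
    proof (rule eventually_sequentiallyI[of d])
      fix n assume n: "d \<le> n"
      let ?R = "\<Prod>i\<le>n. 1 - fps_X * fps_X ^ i :: 'a fps"
      \<comment> \<open>Since \<open>?R * ?Q n = 1\<close> and \<open>?P * inverse ?P = 1\<close>,
        the difference of the inverses is a multiple of \<open>?P - ?Q n\<close>, whose coefficients
        vanish up to degree \<open>d\<close>.\<close>
      have "?R - inverse ?P = ?R * inverse ?P * (?P - ?Q n)"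
        using P Q[of n] by (simp add: algebra_simps)
      moreover have "fps_nth (?P - ?Q n) i = 0" if "i \<le> d" for i
        using that n by (simp add: part_fps_def part_msets_truncate)
      hence "fps_nth (?R * inverse ?P * (?P - ?Q n)) d = 0"
        unfolding fps_mult_nth[of _ "?P - ?Q n"] by (intro sum.neutral) simp
      ultimately show "fps_nth ?R d = fps_nth (inverse ?P) d"
        by (metis eq_iff_diff_eq_0 fps_sub_nth)
    qed
  qed
  \<comment> \<open>\<open>has_prod\<close> with no factors skipped demands a nonzero limit.\<close>
  moreover have "inverse ?P \<noteq> 0" by (simp add: part_fps_nth_0)
  ultimately have "(\<lambda>n. 1 - fps_X * fps_X ^ n) has_prod inverse ?P"
    by (simp add: has_prod_def raw_has_prod_def)
  thus ?thesis unfolding qpoch_inf_def by (rule has_prod_unique[symmetric])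
qed

section \<open>Convergence in the unit disc and evaluation of the product\<close>

lemma fps_conv_radius_ge_1I:
  fixes f :: "'a::{banach, real_normed_field} fps"
  assumes "\<And>r. 0 < r \<Longrightarrow> r < 1 \<Longrightarrow> summable (\<lambda>n. fps_nth f n * of_real r ^ n)"
  shows "fps_conv_radius f \<ge> 1"
  unfolding fps_conv_radius_def
proof (rule conv_radius_geI_ex)
  fix r :: real assume "0 < r" "ereal r < 1"
  hence "summable (\<lambda>n. fps_nth f n * of_real r ^ n)"
    by (intro assms) (simp_all add: one_ereal_def)
  moreover have "norm (of_real r :: 'a) = r" using \<open>0 < r\<close> by simp
  ultimately show "\<exists>z. norm z = r \<and> summable (\<lambda>n. fps_nth f n * z ^ n)" by blast
qed

lemma fps_conv_radius_mult_ge: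
  "c \<le> fps_conv_radius f \<Longrightarrow> c \<le> fps_conv_radius g \<Longrightarrow> c \<le> fps_conv_radius (f * g)"
  by (meson fps_conv_radius_mult min.boundedI order_trans)

lemma fps_conv_radius_one_minus_X_power:
  "fps_conv_radius (1 - fps_X ^ m :: 'a::{banach, real_normed_field} fps) = \<infinity>"
  using fps_conv_radius_diff[of 1 "fps_X ^ m :: 'a fps"] by simp

lemma fps_conv_radius_residue_fps:
  "fps_conv_radius (residue_fps k p :: 'a::{banach, real_normed_field} fps) \<ge> 1"
proof (rule fps_conv_radius_ge_1I)
  fix r :: real assume "0 < r" "r < 1"
  show "summable (\<lambda>n. fps_nth (residue_fps k p) n * (of_real r :: 'a) ^ n)"
    by (rule summable_comparison_test'[where g = "\<lambda>n. r ^ n" and N = 0])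
      (use \<open>0 < r\<close> \<open>r < 1\<close> in \<open>auto simp: residue_fps_def norm_power intro: summable_geometric\<close>)
qed

lemma fps_conv_radius_part_fps_finite:
  assumes "finite A" "0 \<notin> A"
  shows "fps_conv_radius (part_fps A :: 'a::{banach, real_normed_field} fps) \<ge> 1"
  using assms
proof (induction A rule: finite_induct)
  case empty
  thus ?case by (simp add: part_fps_empty)
next
  case (insert m A)
  \<comment> \<open>As \<open>m\<close> is positive, \<open>residue_fps m 0\<close> is the inverse
    of \<open>1 - fps_X ^ m\<close>. Each new part therefore multiplies the series by a geometric
    series of radius at least 1.\<close>
  have "part_fps (insert m A) = part_fps (insert m A) * ((1 - fps_X ^ m) * residue_fps m 0 :: 'a fps)"
    using residue_fps_eq[of 0 m, where 'a = 'a] insert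
    by (simp only: mult.commute[of _ "residue_fps m 0"]) simp
  also have "\<dots> = part_fps A * residue_fps m 0"
    by (simp only: mult.assoc[symmetric] part_fps_insert[OF insert.hyps(2) insert.prems])
  finally show ?case
    using insert by (simp add: fps_conv_radius_mult_ge fps_conv_radius_residue_fps)
qed

lemma eval_part_fps_finite:
  fixes z :: "'a::{banach, real_normed_field}"
  assumes "finite A" "0 \<notin> A" "norm z < 1"
  shows "eval_fps (part_fps A) z * (\<Prod>m\<in>A. 1 - z ^ m) = 1"
  using assms(1,2)
proof (induction A rule: finite_induct)
  case empty
  thus ?case by (simp add: part_fps_empty)
next
  case (insert m A)
  have "ereal (norm z) < 1" using assms(3) by (simp add: one_ereal_def)
  also have "1 \<le> fps_conv_radius (part_fps (insert m A) :: 'a fps)"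
    using insert.hyps insert.prems by (intro fps_conv_radius_part_fps_finite) auto
  finally have r: "ereal (norm z) < fps_conv_radius (part_fps (insert m A) :: 'a fps)" .
  have "eval_fps (part_fps A) z = eval_fps (part_fps (insert m A) * (1 - fps_X ^ m)) z"
    using insert by (subst part_fps_insert) auto
  also have "\<dots> = eval_fps (part_fps (insert m A)) z * (1 - z ^ m)"
    using r by (simp add: eval_fps_mult eval_fps_diff fps_conv_radius_one_minus_X_power)
  finally show ?case using insert by (simp add: mult_ac)
qed

lemma convergent_prod_qpoch:
  fixes q :: "'a::{banach, real_normed_field}"
  assumes "norm q < 1"
  shows "convergent_prod (\<lambda>n. 1 - q * q ^ n)"
proof (intro abs_convergent_prod_imp_convergent_prod summable_imp_abs_convergent_prod)
  show "summable (\<lambda>n. norm (1 - q * q ^ n - 1))"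
    using assms by (simp add: norm_mult norm_power summable_mult summable_geometric)
qed

lemma qpoch_factor_nonzero:
  fixes q :: "'a::real_normed_field"
  assumes "norm q < 1"
  shows "1 - q * q ^ n \<noteq> 0"
proof
  assume "1 - q * q ^ n = 0"
  hence "norm (q ^ Suc n) = 1" by simp
  thus False using assms power_less_one_iff[of "norm q" "Suc n"] by (simp add: norm_power del: power_Suc)
qed

lemma qpoch_inf_nonzero:
  fixes q :: "'a::{banach, real_normed_field}"
  assumes "norm q < 1"
  shows "qpoch_inf q q \<noteq> 0"
  unfolding qpoch_inf_def
  using assms by (intro prodinf_nonzero convergent_prod_qpoch qpoch_factor_nonzero)

text \<open>The values are reciprocals of the partial products, whose limit is nonzero, so inversion
  passes to the limit.\<close>

lemma eval_part_fps_tendsto: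
  fixes q :: "'a::{banach, real_normed_field}"
  assumes "norm q < 1"
  shows "(\<lambda>n. eval_fps (part_fps {0<..Suc n}) q) \<longlonglongrightarrow> inverse (qpoch_inf q q)"
proof -
  have "eval_fps (part_fps {0<..Suc n}) q = inverse (\<Prod>i\<le>n. 1 - q * q ^ i)" for n
    using eval_part_fps_finite[of "{0<..Suc n}" q] assms
    unfolding prod_qpoch_eq by (simp add: inverse_unique mult.commute)
  thus ?thesis
    using assms convergent_prod_LIMSEQ[OF convergent_prod_qpoch[OF assms]]
      qpoch_inf_nonzero[OF assms]
    by (simp add: tendsto_inverse qpoch_inf_def)
qed

text \<open>The partial sums agree with those of the series for parts at most \<open>n + 1\<close>, whose values
  converge to \<open>1 / (r; r)\<^sub>\<infinity>\<close> and are therefore bounded.\<close>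

lemma summable_card_part_msets:
  fixes r :: real
  assumes "0 < r" "r < 1"
  shows "summable (\<lambda>n. real (card (part_msets {0<..} n)) * r ^ n)"
proof -
  have "convergent (\<lambda>n. eval_fps (part_fps {0<..Suc n}) r)"
    using eval_part_fps_tendsto[of r] assms by (auto simp: convergent_def)
  then obtain B where B: "\<And>n. norm (eval_fps (part_fps {0<..Suc n}) r) \<le> B"
    using convergent_imp_Bseq by (metis BseqE)
  show ?thesis
  proof (rule summableI_nonneg_bounded[where x = B])
    fix n
    have "ereal (norm r) < 1" using assms by (simp add: one_ereal_def)
    also have "1 \<le> fps_conv_radius (part_fps {0<..Suc n} :: real fps)"
      by (rule fps_conv_radius_part_fps_finite) auto
    finally have "ereal (norm r) < fps_conv_radius (part_fps {0<..Suc n} :: real fps)" .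
    hence S: "summable (\<lambda>i. fps_nth (part_fps {0<..Suc n}) i * r ^ i)"
      by (rule summable_fps)
    have "(\<Sum>i<n. real (card (part_msets {0<..} i)) * r ^ i)
        = (\<Sum>i<n. fps_nth (part_fps {0<..Suc n}) i * r ^ i)"
      by (intro sum.cong refl) (simp add: part_fps_def part_msets_truncate)
    also have "\<dots> \<le> eval_fps (part_fps {0<..Suc n}) r"
      unfolding eval_fps_def using S assms
      by (intro sum_le_suminf) (auto simp: part_fps_def)
    also have "\<dots> \<le> B" using B[of n] by simp
    finally show "(\<Sum>i<n. real (card (part_msets {0<..} i)) * r ^ i) \<le> B" .
  qed (use assms in simp)
qed

lemma fps_conv_radius_part_fps: "fps_conv_radius (part_fps {0<..} :: complex fps) \<ge> 1"
proof (rule fps_conv_radius_ge_1I)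
  fix r :: real assume "0 < r" "r < 1"
  hence "summable (\<lambda>n. complex_of_real (real (card (part_msets {0<..} n)) * r ^ n))"
    by (intro summable_of_real summable_card_part_msets)
  thus "summable (\<lambda>n. fps_nth (part_fps {0<..}) n * complex_of_real r ^ n)"
    by (simp add: part_fps_def)
qed

lemma eval_part_fps:
  fixes q :: complex
  assumes "norm q < 1"
  shows "eval_fps (part_fps {0<..}) q = inverse (qpoch_inf q q)"
\<comment> \<open>The point 0 is treated apart because the dominating series was shown summable only
  for positive radius.\<close>
proof (cases "q = 0")
  case True
  have "qpoch_inf q q = 1" using True by (simp add: qpoch_inf_def)
  thus ?thesis using True by (simp add: eval_fps_at_0 part_fps_nth_0)
next
  case False
  let ?a = "\<lambda>i n. fps_nth (part_fps {0<..Suc n}) i * q ^ i"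
  let ?b = "\<lambda>i. fps_nth (part_fps {0<..}) i * q ^ i"
  let ?M = "\<lambda>i. real (card (part_msets {0<..} i)) * norm q ^ i"
  have "(\<lambda>n. suminf (\<lambda>i. ?a i n)) \<longlonglongrightarrow> suminf ?b"
  \<comment> \<open>Tannery's theorem is dominated convergence for series. Restricting the part
    sizes only lowers the counts, so the full partition series at \<open>norm q\<close> dominates
    uniformly in \<open>n\<close>.\<close>
  proof (rule tannerys_theorem[THEN conjunct2, THEN conjunct2])
    show "(\<lambda>n. ?a i n) \<longlonglongrightarrow> ?b i" for i
      by (rule tendsto_eventually, rule eventually_sequentiallyI[of i])
        (simp add: part_fps_def part_msets_truncate)
    have "norm (?a i n) \<le> ?M i" for i n
    proof -
      have "card (part_msets {0<..Suc n} i) \<le> card (part_msets {0<..} i)"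
        by (rule card_mono[OF finite_part_msets]) (auto simp: part_msets_def)
      thus ?thesis by (simp add: part_fps_def norm_mult norm_power mult_right_mono)
    qed
    thus "\<forall>\<^sub>F (i, n) in sequentially \<times>\<^sub>F sequentially. norm (?a i n) \<le> ?M i"
      by (simp add: always_eventually split: prod.split)
    show "summable ?M" using False assms by (intro summable_card_part_msets) auto
  qed simp
  thus ?thesis
    using eval_part_fps_tendsto[OF assms] unfolding eval_fps_def by (rule LIMSEQ_unique)
qed

section \<open>The identities for complex arguments\<close>

lemma a_res_sums:
  fixes q :: complex
  assumes "p < k" "norm q < 1"
  shows "(\<lambda>n. of_nat (a_res k p (Suc n)) * q ^ Suc n) sums
     (1 / qpoch_inf q q * ((of_nat p * q ^ p + of_nat (k - p) * q ^ (p + k)) / (1 - q ^ k)\<^sup>2))"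
proof -
  let ?G = "gen_series (a_res k p)" and ?P = "part_fps {0<..} :: complex fps"
  let ?N = "of_nat p * fps_X ^ p + of_nat (k - p) * fps_X ^ (p + k) :: complex fps"
  let ?D = "1 - fps_X ^ k :: complex fps"
  have q: "ereal (norm q) < c" if "1 \<le> c" for c
  proof -
    have "ereal (norm q) < 1" using assms(2) by (simp add: one_ereal_def)
    thus ?thesis using that by (rule less_le_trans)
  qed
  have monom: "fps_conv_radius (of_nat a * fps_X ^ i :: complex fps) = \<infinity>" for a i
    using fps_conv_radius_mult_ge[of \<infinity> "of_nat a" "fps_X ^ i :: complex fps"]
    by (simp flip: fps_of_nat)
  have eval_monom: "eval_fps (of_nat a * fps_X ^ i) q = of_nat a * q ^ i" for a i
    by (simp add: eval_fps_mult flip: fps_of_nat)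
  have N: "fps_conv_radius ?N = \<infinity>"
    using fps_conv_radius_add[of "of_nat p * fps_X ^ p :: complex fps"
        "of_nat (k - p) * fps_X ^ (p + k)"] by (simp add: monom)
  have "fps_conv_radius (fps_X * fps_deriv (residue_fps k p) :: complex fps) \<ge> 1"
    using fps_conv_radius_deriv[of "residue_fps k p :: complex fps"] fps_conv_radius_residue_fps
    by (intro fps_conv_radius_mult_ge) (auto intro: order_trans)
  hence G: "fps_conv_radius ?G \<ge> 1"
    by (simp add: gen_series_a_res fps_XD_def fps_conv_radius_mult_ge fps_conv_radius_part_fps)
  have D: "fps_conv_radius (?D\<^sup>2) = \<infinity>"
    using fps_conv_radius_power[of ?D 2] by (simp add: fps_conv_radius_one_minus_X_power)
  have "eval_fps ?G q * (1 - q ^ k)\<^sup>2 = eval_fps (?G * ?D\<^sup>2) q"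
    using q[OF G] D
    by (simp add: eval_fps_mult eval_fps_power eval_fps_diff fps_conv_radius_one_minus_X_power)
  also have "\<dots> = eval_fps (?P * ?N) q"
    by (simp only: gen_series_a_res_eq[OF assms(1)])
  also have "\<dots> = inverse (qpoch_inf q q) * (of_nat p * q ^ p + of_nat (k - p) * q ^ (p + k))"
    using q[OF fps_conv_radius_part_fps] N
    by (simp add: eval_fps_mult eval_fps_add monom eval_monom eval_part_fps assms(2))
  finally have "eval_fps ?G q * (1 - q ^ k)\<^sup>2
      = inverse (qpoch_inf q q) * (of_nat p * q ^ p + of_nat (k - p) * q ^ (p + k))" .
  \<comment> \<open>\<open>1 - q ^ k\<close> is the factor of index \<open>k - 1\<close> in the
    product, where \<open>k\<close> is positive because \<open>p < k\<close>.\<close>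
  moreover have "(1 - q ^ k)\<^sup>2 \<noteq> 0"
    using qpoch_factor_nonzero[OF assms(2), of "k - 1"] assms(1) by (simp flip: power_Suc)
  ultimately have "eval_fps ?G q = 1 / qpoch_inf q q *
      ((of_nat p * q ^ p + of_nat (k - p) * q ^ (p + k)) / (1 - q ^ k)\<^sup>2)"
    unfolding times_divide_eq_right inverse_eq_divide by (rule eq_divide_imp[rotated])
  moreover have "(\<lambda>n. fps_nth ?G n * q ^ n) sums eval_fps ?G q"
    by (rule sums_eval_fps) (rule q[OF G])
  \<comment> \<open>The zero constant term is added explicitly to match the shape of
    \<open>sums_Suc_iff\<close>, which then starts the series at exponent 1.\<close>
  ultimately have "(\<lambda>n. fps_nth ?G n * q ^ n) sums (1 / qpoch_inf q q *
      ((of_nat p * q ^ p + of_nat (k - p) * q ^ (p + k)) / (1 - q ^ k)\<^sup>2) + fps_nth ?G 0 * q ^ 0)"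
    by (simp add: gen_series_def)
  hence "(\<lambda>n. fps_nth ?G (Suc n) * q ^ Suc n) sums (1 / qpoch_inf q q *
      ((of_nat p * q ^ p + of_nat (k - p) * q ^ (p + k)) / (1 - q ^ k)\<^sup>2))"
    by (subst sums_Suc_iff)
  thus ?thesis by (simp add: gen_series_def)
qed

section \<open>Negative exponents and the final identities\<close>

text \<open>For \<open>x = 0\<close> the negative power is the junk value \<open>0\<close>; both sides vanish as \<open>p < k\<close>.\<close>

lemma numerator_conv_power_int:
  fixes x :: "'a::field"
  assumes "p < k"
  shows "of_nat p * x ^ p + c * x ^ (p + k)
       = (of_nat p * x powi (int p - int k) + c * x ^ p) * x ^ k"
proof (cases "x = 0")
  case True
  thus ?thesis using assms by (cases p) auto
next
  case False
  hence "x powi (int p - int k) * x ^ k = x ^ p"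
    by (simp add: power_int_diff)
  thus ?thesis by (simp add: distrib_right power_add mult.assoc)
qed

text \<open>The exponent \<open>p - k\<close> is negative, so the formal identity for
  \<open>a_res\<close> is stated in Laurent series; the other two stay within power series.\<close>

theorem theorem2p1:
  fixes k p :: nat
  assumes "k \<ge> 1" and "p \<le> k - 1"
  shows
    "(gen_series (a_div k)
        = 1 / qpoch_inf fps_X fps_X * (of_nat k * fps_X ^ k / (1 - fps_X ^ k)\<^sup>2)
      \<and> fps_to_fls (gen_series (a_res k p))
        = 1 / fps_to_fls (qpoch_inf fps_X fps_X)
          * ((of_nat p * fls_X powi (int p - int k) + of_nat (k - p) * fls_X ^ p) * fls_X ^ k
              / (1 - fls_X ^ k)\<^sup>2)
      \<and> gen_series (b_rep k)
        = 1 / qpoch_inf fps_X fps_X * (fps_X ^ k / (1 - fps_X ^ k)\<^sup>2))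
     \<and> (\<forall>q::complex. norm q < 1 \<longrightarrow>
        (\<lambda>n. of_nat (a_div k (Suc n)) * q ^ Suc n)
          sums (1 / qpoch_inf q q * (of_nat k * q ^ k / (1 - q ^ k)\<^sup>2))
      \<and> (\<lambda>n. of_nat (a_res k p (Suc n)) * q ^ Suc n)
          sums (1 / qpoch_inf q q
            * ((of_nat p * q powi (int p - int k) + of_nat (k - p) * q ^ p) * q ^ k
                / (1 - q ^ k)\<^sup>2))
      \<and> (\<lambda>n. of_nat (b_rep k (Suc n)) * q ^ Suc n)
          sums (1 / qpoch_inf q q * (q ^ k / (1 - q ^ k)\<^sup>2)))"
proof -
  have pk: "p < k" and k: "0 < k" using assms by auto
  let ?E = "qpoch_inf fps_X fps_X :: complex fps" and ?D = "1 - fps_X ^ k :: complex fps"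
  let ?P = "part_fps {0<..} :: complex fps"
  have P: "?P = 1 / ?E"
    by (simp add: qpoch_inf_fps fps_divide_unit part_fps_nth_0 fps_inverse_idempotent)
  have EP: "?E * ?P = 1"
    unfolding qpoch_inf_fps by (rule inverse_mult_eq_1) (simp add: part_fps_nth_0)
  have D0: "fps_nth (?D\<^sup>2) 0 \<noteq> 0" using k by (simp add: power2_eq_square)
  \<comment> \<open>The nonzero constant term makes \<open>?D\<^sup>2\<close> a unit, so formal
    division by it is multiplication by its inverse.\<close>
  have divI: "f = ?P * (g / ?D\<^sup>2)" if "f * ?D\<^sup>2 = ?P * g" for f g
  proof -
    have "f = f * ?D\<^sup>2 * inverse (?D\<^sup>2)"
      by (simp only: mult.assoc inverse_mult_eq_1'[OF D0] mult_1_right)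
    thus ?thesis
      by (simp only: that fps_divide_unit[OF D0] mult.assoc)
  qed
  have fps_a: "gen_series (a_div k) = 1 / ?E * (of_nat k * fps_X ^ k / ?D\<^sup>2)"
    unfolding P[symmetric] using gen_series_a_res_eq[OF k]
    by (intro divI) (simp add: a_div_eq_a_res[abs_def])
  have "of_nat k * gen_series (b_rep k) = gen_series (a_div k)"
    by (simp add: fps_eq_iff gen_series_def a_div_eq_b_rep[OF assms(1)] flip: fps_of_nat)
  also have "\<dots> = of_nat k * (1 / ?E * (fps_X ^ k / ?D\<^sup>2))"
    unfolding fps_a using D0 by (simp add: fps_divide_unit mult_ac)
  \<comment> \<open>The factor \<open>k\<close> cancels since it is nonzero in a domain of
    characteristic 0.\<close>
  finally have fps_b: "gen_series (b_rep k) = 1 / ?E * (fps_X ^ k / ?D\<^sup>2)"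
    using k by simp
  let ?F = "fps_to_fls (gen_series (a_res k p))"
  let ?d = "1 - fls_X ^ k :: complex fls"
  let ?N = "(of_nat p * fls_X powi (int p - int k) + of_nat (k - p) * fls_X ^ p) * fls_X ^ k :: complex fls"
  have D_fls: "fps_to_fls ?D = ?d" by (simp add: fps_to_fls_power)
  \<comment> \<open>All denominators are cleared among power series first; only then is the identity
    embedded in the field of Laurent series and divided.\<close>
  have "gen_series (a_res k p) * (?E * ?D\<^sup>2) = ?E * (gen_series (a_res k p) * ?D\<^sup>2)"
    by (simp only: mult_ac)
  also have "\<dots> = ?E * ?P * (of_nat p * fps_X ^ p + of_nat (k - p) * fps_X ^ (p + k))"
    by (simp only: gen_series_a_res_eq[OF pk] mult.assoc)
  finally have "gen_series (a_res k p) * (?E * ?D\<^sup>2)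
      = of_nat p * fps_X ^ p + of_nat (k - p) * fps_X ^ (p + k)"
    unfolding EP by simp
  hence "fps_to_fls (gen_series (a_res k p) * (?E * ?D\<^sup>2))
      = fps_to_fls (of_nat p * fps_X ^ p + of_nat (k - p) * fps_X ^ (p + k))"
    by (rule arg_cong)
  hence "?F * (fps_to_fls ?E * ?d\<^sup>2) = of_nat p * fls_X ^ p + of_nat (k - p) * fls_X ^ (p + k)"
    by (simp add: fls_times_fps_to_fls fps_to_fls_power)
  also have "\<dots> = ?N"
    by (rule numerator_conv_power_int[OF pk])
  finally have "?F * (fps_to_fls ?E * ?d\<^sup>2) = ?N" .
  moreover have "fps_to_fls ?E * ?d\<^sup>2 \<noteq> 0"
  proof -
    have "?D \<noteq> 0"
    proof
      assume "?D = 0"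
      with D0 show False by (simp only: zero_power2 fps_zero_nth simp_thms)
    qed
    moreover have "?E \<noteq> 0" using EP by auto
    ultimately show ?thesis
      by (simp only: D_fls[symmetric] mult_eq_0_iff power_eq_0_iff fps_to_fls_eq_0_iff simp_thms)
  qed
  ultimately have "?F = ?N / (fps_to_fls ?E * ?d\<^sup>2)"
    by (rule eq_divide_imp[rotated])
  hence fls: "?F = 1 / fps_to_fls ?E * (?N / ?d\<^sup>2)"
    by (simp only: times_divide_times_eq mult_1_left)
  have "(\<lambda>n. of_nat (a_div k (Suc n)) * q ^ Suc n)
          sums (1 / qpoch_inf q q * (of_nat k * q ^ k / (1 - q ^ k)\<^sup>2))
      \<and> (\<lambda>n. of_nat (a_res k p (Suc n)) * q ^ Suc n)
          sums (1 / qpoch_inf q q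
            * ((of_nat p * q powi (int p - int k) + of_nat (k - p) * q ^ p) * q ^ k
                / (1 - q ^ k)\<^sup>2))
      \<and> (\<lambda>n. of_nat (b_rep k (Suc n)) * q ^ Suc n)
          sums (1 / qpoch_inf q q * (q ^ k / (1 - q ^ k)\<^sup>2))"
    if q: "norm q < 1" for q :: complex
  proof -
    have a: "(\<lambda>n. of_nat (a_div k (Suc n)) * q ^ Suc n)
        sums (1 / qpoch_inf q q * (of_nat k * q ^ k / (1 - q ^ k)\<^sup>2))"
      using a_res_sums[OF k q] by (simp add: a_div_eq_a_res)
    \<comment> \<open>Scaling the series for \<open>a_div\<close> by \<open>1 / k\<close> gives the
      one for \<open>b_rep\<close>.\<close>
    have b: "(\<lambda>n. of_nat (b_rep k (Suc n)) * q ^ Suc n)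
        sums (1 / qpoch_inf q q * (q ^ k / (1 - q ^ k)\<^sup>2))"
      using sums_mult[OF a, of "1 / of_nat k"] k
      by (simp add: a_div_eq_b_rep[OF assms(1)])
    have "of_nat p * q ^ p + of_nat (k - p) * q ^ (p + k)
        = (of_nat p * q powi (int p - int k) + of_nat (k - p) * q ^ p) * q ^ k"
      by (rule numerator_conv_power_int[OF pk])
    with a b a_res_sums[OF pk q] show ?thesis by (simp only: simp_thms)
  qed
  with fps_a fls fps_b show ?thesis by blast
qed

end
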